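(* Let $G$ be a finite, connected, simple undirected graph with vertex set $V$ and edge set $E$. Let $\nu$ be the map from the set of $G$-semiorders to the set of $G$-semiorientations given by $\nu(P)=\{(u,v):\{u,v\}\in E,\ u<v \text{ in } P\}$. Then $\nu$ is bijective if and only if $G$ is a complete graph.
   Context: A semiorder is a poset isomorphic to the order on a finite set of unit closed intervals $[a,a+1]$ of $\mathbb{R}$ with $[a,a+1]<[b,b+1]$ iff $a+1<b$; a $G$-semiorder is a semiorder on the set $V$. A partial orientation is a subset $\mathcal{O}\subseteq V\times V$ with $(u,v)\in\mathcal{O}\Rightarrow\{u,v\}\in E$ and $(v,u)\notin\mathcal{O}$; edges not oriented are blank. A potential cycle for $\mathcal{O}$ is a cycle of $G$ whose blank edges can be directed to make it a directed cycle. A $G$-semiorientation is a partial orientation whose every potential cycle has strictly more blank edges than oriented edges. *)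

theory Defs
  imports Complex_Main "Graph_Theory.Graph_Theory"
begin

text \<open>
  A finite simple undirected graph is a \<^locale>\<open>pair_graph\<close>: a finite loop-free digraph in
  which every undirected edge \<open>{u, v}\<close> appears as the two opposite arcs \<open>(u, v)\<close> and \<open>(v, u)\<close>.
\<close>

definition undirected :: "('a \<times> 'a) set \<Rightarrow> 'a set set" where
  "undirected A = (\<lambda>(u, v). {u, v}) ` A"

definition edges :: "'a pair_pre_digraph \<Rightarrow> 'a set set" where
  "edges G = undirected (parcs G)"

definition complete_graph :: "'a pair_pre_digraph \<Rightarrow> bool" where
  "complete_graph G \<longleftrightarrow> (\<exists>n. complete_digraph n (with_proj G))"


section \<open>Semiorders\<close>

definition unit_intervals :: "real set set" where
  "unit_intervals = {{a..a + 1} | a. True}"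

definition interval_less :: "real set \<Rightarrow> real set \<Rightarrow> bool" where
  "interval_less I J \<longleftrightarrow> (\<exists>a b. I = {a..a + 1} \<and> J = {b..b + 1} \<and> a + 1 < b)"

text \<open>
  A poset on \<open>V\<close> is given by its strict order relation \<open>P\<close>: the pair \<open>(u, v)\<close> is in \<open>P\<close>
  iff \<open>u < v\<close>.
\<close>

definition strict_poset_on :: "'a set \<Rightarrow> ('a \<times> 'a) set \<Rightarrow> bool" where
  "strict_poset_on V P \<longleftrightarrow> P \<subseteq> V \<times> V \<and> irrefl P \<and> trans P"

definition semiorder_on :: "'a set \<Rightarrow> ('a \<times> 'a) set \<Rightarrow> bool" where
  "semiorder_on V P \<longleftrightarrow> strict_poset_on V P \<and>
     (\<exists>S f. finite S \<and> S \<subseteq> unit_intervals \<and> bij_betw f V S \<and>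
        (\<forall>u\<in>V. \<forall>v\<in>V. (u, v) \<in> P \<longleftrightarrow> interval_less (f u) (f v)))"

definition semiorders :: "'a pair_pre_digraph \<Rightarrow> ('a \<times> 'a) set set" where
  "semiorders G = {P. semiorder_on (pverts G) P}"


section \<open>Semiorientations\<close>

text \<open>
  The library's \<^const>\<open>pre_digraph.cycle\<close> also admits the closed walk \<open>(u, v), (v, u)\<close>, which
  uses one undirected edge twice; the length condition excludes it. The arcs of any other
  library cycle are a directed cycle on an undirected cycle of the graph.
\<close>

definition directed_cycles :: "'a pair_pre_digraph \<Rightarrow> ('a \<times> 'a) set set" where
  "directed_cycles G = {set p | p. pre_digraph.cycle (with_proj G) p \<and> 3 \<le> length p}"

definition cycles :: "'a pair_pre_digraph \<Rightarrow> 'a set set set" where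
  "cycles G = undirected ` directed_cycles G"

definition partial_orientation :: "'a pair_pre_digraph \<Rightarrow> ('a \<times> 'a) set \<Rightarrow> bool" where
  "partial_orientation G Or \<longleftrightarrow> Or \<subseteq> pverts G \<times> pverts G \<and>
     (\<forall>u v. (u, v) \<in> Or \<longrightarrow> {u, v} \<in> edges G \<and> (v, u) \<notin> Or)"

definition oriented_edges :: "'a pair_pre_digraph \<Rightarrow> ('a \<times> 'a) set \<Rightarrow> 'a set set" where
  "oriented_edges G Or = edges G \<inter> undirected Or"

definition blank_edges :: "'a pair_pre_digraph \<Rightarrow> ('a \<times> 'a) set \<Rightarrow> 'a set set" where
  "blank_edges G Or = edges G - undirected Or"

text \<open>
  \<open>D\<close> is the directed cycle obtained from \<open>C\<close> by directing its blank edges: it contains each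
  edge of \<open>C\<close> in exactly one direction and agrees with \<open>Or\<close> on the oriented ones.
\<close>

definition potential_cycle ::
    "'a pair_pre_digraph \<Rightarrow> ('a \<times> 'a) set \<Rightarrow> 'a set set \<Rightarrow> bool" where
  "potential_cycle G Or C \<longleftrightarrow> C \<in> cycles G \<and>
     (\<exists>D \<in> directed_cycles G. undirected D = C \<and>
        (\<forall>u v. (u, v) \<in> Or \<and> {u, v} \<in> C \<longrightarrow> (u, v) \<in> D))"

definition semiorientation :: "'a pair_pre_digraph \<Rightarrow> ('a \<times> 'a) set \<Rightarrow> bool" where
  "semiorientation G Or \<longleftrightarrow> partial_orientation G Or \<and>
     (\<forall>C. potential_cycle G Or C \<longrightarrow>
        card (C \<inter> blank_edges G Or) > card (C \<inter> oriented_edges G Or))"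

definition semiorientations :: "'a pair_pre_digraph \<Rightarrow> ('a \<times> 'a) set set" where
  "semiorientations G = {Or. semiorientation G Or}"

definition nu :: "'a pair_pre_digraph \<Rightarrow> ('a \<times> 'a) set \<Rightarrow> ('a \<times> 'a) set" where
  "nu G P = {(u, v). {u, v} \<in> edges G \<and> (u, v) \<in> P}"


section \<open>The map is well defined\<close>

lemma interval_less_iff [simp]: "interval_less {a..a + 1} {b..b + 1} \<longleftrightarrow> a + 1 < b"
proof -
  have "{x..x + 1} = {y..y + 1} \<longleftrightarrow> x = y" for x y :: real
    by (auto simp: Icc_eq_Icc)
  then show ?thesis
    unfolding interval_less_def by auto
qed

lemma semiorder_on_endpoints:
  assumes "semiorder_on V P"
  obtains a :: "'a \<Rightarrow> real"
  where "inj_on a V" "\<And>u v. u \<in> V \<Longrightarrow> v \<in> V \<Longrightarrow> (u, v) \<in> P \<longleftrightarrow> a u + 1 < a v"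
proof -
  obtain S f where S: "S \<subseteq> unit_intervals" and f: "bij_betw f V S"
    and iso: "\<forall>u\<in>V. \<forall>v\<in>V. (u, v) \<in> P \<longleftrightarrow> interval_less (f u) (f v)"
    using assms unfolding semiorder_on_def by blast
  have "\<forall>u\<in>V. \<exists>a. f u = {a..a + 1}"
    using S f unfolding unit_intervals_def bij_betw_def by blast
  then obtain a where a: "\<And>u. u \<in> V \<Longrightarrow> f u = {a u..a u + 1}"
    by metis
  show thesis
  proof (rule that)
    show "inj_on a V"
      using f a unfolding bij_betw_def inj_on_def by metis
    show "(u, v) \<in> P \<longleftrightarrow> a u + 1 < a v" if "u \<in> V" "v \<in> V" for u v
      using that iso a by simp
  qed
qed

lemma (in pair_wf_digraph) cycle_nth_conv:
  assumes "cas u p w" "i < length p"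
  shows "fst (p ! i) = (if i = 0 then u else snd (p ! (i - 1)))"
  using assms by (induction p arbitrary: u i) (auto simp: nth_Cons split: nat.split)

lemma (in pair_wf_digraph) cas_last_snd:
  assumes "cas u p w" "p \<noteq> []"
  shows "snd (p ! (length p - 1)) = w"
  using assms
proof (induction p arbitrary: u)
  case (Cons e p)
  then show ?case by (cases p) auto
qed simp

lemma (in pair_wf_digraph) cas_tl_verts:
  "cas u p w \<Longrightarrow> tl (awalk_verts u p) = map snd p"
proof (induction p arbitrary: u)
  case (Cons e p)
  then show ?case by (cases p) auto
qed simp

lemma (in pair_wf_digraph) cas_sum_diff:
  fixes a :: "'a \<Rightarrow> real"
  shows "cas u p w \<Longrightarrow> (\<Sum>e\<leftarrow>p. a (snd e) - a (fst e)) = a w - a u"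
  by (induction p arbitrary: u) auto

lemma (in pair_wf_digraph) inj_on_undirected_cycle:
  assumes "cycle p" "3 \<le> length p"
  shows "inj_on (\<lambda>(u, v). {u, v}) (set p)"
proof -
  obtain u where cas: "cas u p u" and dist: "distinct (tl (awalk_verts u p))"
    using assms(1) unfolding cycle_def awalk_def by auto
  have dist: "distinct (map snd p)"
    using dist cas_tl_verts[OF cas] by simp
  have eqI: "i = j" if "snd (p ! i) = snd (p ! j)" "i < length p" "j < length p" for i j
    using dist that by (simp add: distinct_conv_nth) metis
  have no_rev: False
    if ij: "i < j" "j < length p" "p ! i = (x, y)" "p ! j = (y, x)" for i j x y
  proof -
    have "y = snd (p ! (j - 1))"
      using cycle_nth_conv[OF cas ij(2)] ij by simp
    then have j: "j - 1 = i"
      using ij by (intro eqI) auto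
    show False
    proof (cases "i = 0")
      case True
      then have "x = u"
        using cycle_nth_conv[OF cas, of i] ij by fastforce
      moreover have "snd (p ! (length p - 1)) = u"
        using cas_last_snd[OF cas] ij by force
      ultimately have "length p - 1 = j"
        using ij by (intro eqI) auto
      then show False using True j assms(2) by linarith
    next
      case False
      then have "x = snd (p ! (i - 1))"
        using cycle_nth_conv[OF cas, of i] ij by simp
      then have "i - 1 = j"
        using ij by (intro eqI) auto
      then show False using ij by linarith
    qed
  qed
  have no_rev': False if rev: "(x, y) \<in> set p" "(y, x) \<in> set p" "x \<noteq> y" for x y
  proof -
    obtain i where i: "i < length p" "p ! i = (x, y)"
      using rev(1) unfolding in_set_conv_nth by blast
    obtain j where j: "j < length p" "p ! j = (y, x)"
      using rev(2) unfolding in_set_conv_nth by blast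
    consider "i < j" | "j < i" | "i = j" by linarith
    then show False
    proof cases
      case 1
      show False by (rule no_rev[OF 1 j(1) i(2) j(2)])
    next
      case 2
      show False by (rule no_rev[OF 2 i(1) j(2) i(2)])
    next
      case 3
      then show False using i(2) j(2) rev(3) by simp
    qed
  qed
  show ?thesis
  proof (rule inj_onI)
    fix e e' assume e: "e \<in> set p" "e' \<in> set p"
      and eq: "(case e of (u, v) \<Rightarrow> {u, v}) = (case e' of (u, v) \<Rightarrow> {u, v})"
    obtain x y where x: "e = (x, y)" by (cases e)
    obtain x' y' where x': "e' = (x', y')" by (cases e')
    note xy = x x'
    from eq xy have "x = x' \<and> y = y' \<or> x = y' \<and> y = x'"
      by (simp add: doubleton_eq_iff)
    then show "e = e'"
    proof
      assume "x = y' \<and> y = x'"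
      then show "e = e'" using no_rev'[of x y] e xy by (cases "x = y") auto
    qed (simp add: xy)
  qed
qed

lemma nu_semiorientation:
  assumes G: "pair_graph G" and P: "P \<in> semiorders G"
  shows "nu G P \<in> semiorientations G"
proof -
  interpret pair_graph G by (rule G)
  have PV: "P \<subseteq> pverts G \<times> pverts G" and irr: "irrefl P" and tr: "trans P"
    using P by (auto simp: semiorders_def semiorder_on_def strict_poset_on_def)
  have so: "semiorder_on (pverts G) P"
    using P by (simp add: semiorders_def)
  obtain a :: "'a \<Rightarrow> real"
    where a: "\<And>u v. u \<in> pverts G \<Longrightarrow> v \<in> pverts G \<Longrightarrow> (u, v) \<in> P \<longleftrightarrow> a u + 1 < a v"
    using semiorder_on_endpoints[OF so] by metis
  have "partial_orientation G (nu G P)"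
    unfolding partial_orientation_def nu_def
    using PV irr tr by (auto simp: irrefl_def dest: transD)
  moreover have "card (C \<inter> oriented_edges G (nu G P)) < card (C \<inter> blank_edges G (nu G P))"
    if C: "potential_cycle G (nu G P) C" for C
  proof -
    obtain p where p: "cycle p" "3 \<le> length p" and Cp: "C = undirected (set p)"
      and agree: "\<And>u v. (u, v) \<in> nu G P \<Longrightarrow> {u, v} \<in> C \<Longrightarrow> (u, v) \<in> set p"
      using C unfolding potential_cycle_def directed_cycles_def by blast
    obtain u where cas: "cas u p u" and dist: "distinct p" and sub: "set p \<subseteq> parcs G"
      using p(1) unfolding cycle_conv awalk_def by auto
    define h where "h = (\<lambda>(x :: 'a, y). {x, y})"
    have inj: "inj_on h (set p)"
      using inj_on_undirected_cycle[OF p] unfolding h_def .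
    have Ch: "C = h ` set p"
      unfolding Cp undirected_def h_def ..
    define N where "N = set p \<inter> nu G P"
    have CE: "C \<subseteq> edges G"
      unfolding Cp edges_def undirected_def using sub by auto
    have "h e \<in> undirected (nu G P) \<longleftrightarrow> e \<in> nu G P" if e: "e \<in> set p" for e
    proof
      assume "h e \<in> undirected (nu G P)"
      then obtain x y where xy: "(x, y) \<in> nu G P" "h e = h (x, y)"
        unfolding undirected_def h_def by auto
      have "h (x, y) \<in> C" using e xy(2) Ch by auto
      then have "(x, y) \<in> set p" using agree xy(1) unfolding h_def by simp
      then have "e = (x, y)" using inj e xy(2) by (auto dest: inj_onD)
      then show "e \<in> nu G P" using xy(1) by simp
    next
      assume "e \<in> nu G P"
      then show "h e \<in> undirected (nu G P)" unfolding undirected_def h_def by blast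
    qed
    then have "C \<inter> oriented_edges G (nu G P) = h ` N"
      "C \<inter> blank_edges G (nu G P) = h ` (set p - N)"
      using CE unfolding oriented_edges_def blank_edges_def Ch N_def by auto
    then have cards: "card (C \<inter> oriented_edges G (nu G P)) = card N"
      "card (C \<inter> blank_edges G (nu G P)) = card (set p - N)"
      using inj by (auto simp: N_def intro!: card_image inj_on_subset[OF inj])
    define d where "d e = a (snd e) - a (fst e)" for e
    have "0 = (\<Sum>e\<in>set p. d e)"
      using cas_sum_diff[OF cas, of a] dist by (simp add: sum_list_distinct_conv_sum_set d_def)
    also have "\<dots> = sum d N + sum d (set p - N)"
      by (subst sum.subset_diff[of N]) (auto simp: N_def)
    finally have zero: "sum d N + sum d (set p - N) = 0" by simp
    have verts: "fst e \<in> pverts G" "snd e \<in> pverts G" if "e \<in> set p" for e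
      using that sub arc_fst_in_verts arc_snd_in_verts by auto
    have dN: "1 < d e" if "e \<in> N" for e
      using that a[of "fst e" "snd e"] verts[of e] by (auto simp: N_def nu_def d_def)
    have edge: "{fst e, snd e} \<in> edges G" if "e \<in> set p" for e
    proof -
      have "h e \<in> edges G" using that CE Ch by blast
      then show ?thesis by (cases e) (simp add: h_def)
    qed
    have not_rev: "(snd e, fst e) \<notin> P" if "e \<in> set p" for e
    proof
      assume rev: "(snd e, fst e) \<in> P"
      have "(snd e, fst e) \<in> nu G P"
        using rev edge[OF that] by (simp add: nu_def insert_commute)
      moreover have eC: "{snd e, fst e} = h e" "h e \<in> C"
        using that Ch by (auto simp: h_def split: prod.splits)
      ultimately have "(snd e, fst e) \<in> set p" using agree by simp
      moreover have "h (snd e, fst e) = h e" using eC(1) by (simp add: h_def)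
      ultimately have "(snd e, fst e) = e" using inj that by (metis inj_onD)
      then have "snd e = fst e" by (metis fst_conv)
      then show False using rev irr by (simp add: irrefl_def)
    qed
    have dB: "d e \<le> 1" "-1 \<le> d e" if "e \<in> set p - N" for e
    proof -
      have "e \<notin> P" using that edge[of e] by (cases e) (auto simp: N_def nu_def)
      then show "d e \<le> 1" using that a[of "fst e" "snd e"] verts[of e] by (auto simp: d_def)
      have "(snd e, fst e) \<notin> P" using not_rev[of e] that by blast
      then show "-1 \<le> d e" using that a[of "snd e" "fst e"] verts[of e] by (auto simp: d_def)
    qed
    have "sum (\<lambda>_. - 1) (set p - N) \<le> sum d (set p - N)"
      by (rule sum_mono) (use dB in auto)
    then have B: "- real (card (set p - N)) \<le> sum d (set p - N)" by simp
    have "card N < card (set p - N)"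
    proof (cases "N = {}")
      case True
      then show ?thesis using dist p(2) by (auto simp: distinct_card)
    next
      case False
      have "sum (\<lambda>_. 1) N < sum d N"
        by (rule sum_strict_mono) (use False dN in \<open>auto simp: N_def\<close>)
      then have "real (card N) < sum d N" by simp
      then show ?thesis using B zero by linarith
    qed
    then show ?thesis using cards by simp
  qed
  ultimately show ?thesis
    unfolding semiorientations_def semiorientation_def by simp
qed

end

theory Submission
  imports Defs
begin

text \<open>
  If \<open>x\<close> and \<open>y\<close> are distinct and not adjacent, then the empty order and the order whose only
  relation is \<open>x < y\<close> are two semiorders with empty image, so \<open>\<nu>\<close> is not injective. If \<open>G\<close> is
  complete, \<open>\<nu>\<close> is the identity on semiorders. It is onto because in a semiorientation of a
  complete graph no potential 3-cycle has two oriented edges and no potential 4-cycle has two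
  either; this gives transitivity and forbids the posets \<open>2 + 2\<close> and \<open>3 + 1\<close>, which by the
  theorem of Scott and Suppes characterises semiorders.
\<close>

section \<open>The Scott--Suppes theorem\<close>

text \<open>Injectivity is required because \<open>semiorder_on\<close> asks for a bijection with a
  set of intervals: elements with the same relations still need different intervals.\<close>

lemma semiorder_onI:
  fixes a :: "'a \<Rightarrow> real"
  assumes "finite V" "strict_poset_on V P" "inj_on a V"
    and "\<And>u v. u \<in> V \<Longrightarrow> v \<in> V \<Longrightarrow> (u, v) \<in> P \<longleftrightarrow> a u + 1 < a v"
  shows "semiorder_on V P"
proof -
  let ?f = "\<lambda>v. {a v..a v + 1}"
  have "inj_on ?f V"
    using assms(3) by (auto simp: inj_on_def Icc_eq_Icc)
  then have "bij_betw ?f V (?f ` V)"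
    by (simp add: bij_betw_def)
  moreover have "\<forall>u\<in>V. \<forall>v\<in>V. (u, v) \<in> P \<longleftrightarrow> interval_less (?f u) (?f v)"
    using assms(4) by simp
  moreover have "?f ` V \<subseteq> unit_intervals"
    by (auto simp: unit_intervals_def)
  ultimately show ?thesis
    unfolding semiorder_on_def using assms(1,2) by (meson finite_imageI)
qed

lemma separating_point:
  fixes L U :: "real set"
  assumes "finite L" "finite U" "\<And>l u. l \<in> L \<Longrightarrow> u \<in> U \<Longrightarrow> l < u"
  obtains r where "\<forall>l\<in>L. l < r" "\<forall>u\<in>U. r < u"
proof (cases "L = {} \<or> U = {}")
  case True
  then show thesis
  proof
    assume "L = {}"
    obtain r where "\<forall>u\<in>U. r < u"
      using assms(2) by (metis bdd_below.E bdd_below_finite lt_ex order_less_le_trans)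
    then show thesis using \<open>L = {}\<close> that by blast
  next
    assume "U = {}"
    obtain r where "\<forall>l\<in>L. l < r"
      using assms(1) by (metis bdd_above.E bdd_above_finite gt_ex order_le_less_trans)
    then show thesis using \<open>U = {}\<close> that by blast
  qed
next
  case False
  then have "Max L < Min U" using assms by simp
  then obtain r where "Max L < r" "r < Min U" using dense by blast
  then show thesis using False assms(1,2) by (intro that) auto
qed

text \<open>Left endpoints are assigned in order of increasing \<open>f\<close>, each to the right
  of all earlier ones. The conclusion is made strong enough for this induction: the strict
  \<open>a v < a u + 1\<close> for unrelated pairs leaves an open gap for the next endpoint, and the
  conjunct \<open>f u \<le> f v\<close> lets the order of endpoints be read back as an order of
  ranks.\<close>

lemma unit_representation:
  fixes f :: "'a \<Rightarrow> int"
  assumes "finite S" and irr: "irrefl P"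
    and pred: "\<And>u v w. u \<in> S \<Longrightarrow> v \<in> S \<Longrightarrow> f u \<le> f v \<Longrightarrow> (w, u) \<in> P \<Longrightarrow> (w, v) \<in> P"
    and succ: "\<And>u v w. u \<in> S \<Longrightarrow> v \<in> S \<Longrightarrow> f u \<le> f v \<Longrightarrow> (v, w) \<in> P \<Longrightarrow> (u, w) \<in> P"
  shows "\<exists>a :: 'a \<Rightarrow> real. inj_on a S \<and>
    (\<forall>u\<in>S. \<forall>v\<in>S. a u < a v \<longrightarrow>
      f u \<le> f v \<and> ((u, v) \<in> P \<longrightarrow> a u + 1 < a v) \<and> ((u, v) \<notin> P \<longrightarrow> a v < a u + 1))"
  using assms(1) pred succ
proof (induction S rule: finite_ranking_induct[where f = f])
  case empty
  show ?case by simp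
next
  case (insert x S)
  show ?case
  proof (cases "x \<in> S")
    \<comment> \<open>\<open>finite_ranking_induct\<close> does not promise that \<open>x\<close> is
      new.\<close>
    case True
    then have S: "insert x S = S" by (rule insert_absorb)
    show ?thesis
      unfolding S by (rule insert.IH) (fact insert.prems[unfolded S])+
  next
    case False
    note pred = insert.prems(1) and succ = insert.prems(2)
    have "\<exists>a :: 'a \<Rightarrow> real. inj_on a S \<and> (\<forall>u\<in>S. \<forall>v\<in>S. a u < a v \<longrightarrow>
        f u \<le> f v \<and> ((u, v) \<in> P \<longrightarrow> a u + 1 < a v) \<and> ((u, v) \<notin> P \<longrightarrow> a v < a u + 1))"
    proof (rule insert.IH)
      show "(w, v) \<in> P" if "u \<in> S" "v \<in> S" "f u \<le> f v" "(w, u) \<in> P" for u v w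
        using pred[of u v w] that by blast
      show "(u, w) \<in> P" if "u \<in> S" "v \<in> S" "f u \<le> f v" "(v, w) \<in> P" for u v w
        using succ[of u v w] that by blast
    qed
    then obtain a :: "'a \<Rightarrow> real" where inj: "inj_on a S"
      and mono: "\<And>u v. u \<in> S \<Longrightarrow> v \<in> S \<Longrightarrow> a u < a v \<Longrightarrow> f u \<le> f v"
      and rep: "\<And>u v. u \<in> S \<Longrightarrow> v \<in> S \<Longrightarrow> a u < a v \<Longrightarrow> (u, v) \<in> P \<Longrightarrow> a u + 1 < a v"
      and rep': "\<And>u v. u \<in> S \<Longrightarrow> v \<in> S \<Longrightarrow> a u < a v \<Longrightarrow> (u, v) \<notin> P \<Longrightarrow> a v < a u + 1"
      by blast
    \<comment> \<open>These are the strict lower and upper bounds on the endpoint \<open>r\<close>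
      of \<open>x\<close>: beyond all earlier endpoints, more than one unit beyond those of
      predecessors of \<open>x\<close>, and less than one unit beyond the others.\<close>
    define L where "L = a ` S \<union> (\<lambda>u. a u + 1) ` {u \<in> S. (u, x) \<in> P}"
    define U where "U = (\<lambda>u. a u + 1) ` {u \<in> S. (u, x) \<notin> P}"
    \<comment> \<open>Since \<open>x\<close> ranks at least as high as \<open>u\<close>, it has all
      predecessors of \<open>u\<close>; so \<open>v\<close>, not being below \<open>x\<close>, is
      not below \<open>u\<close> either.\<close>
    have 1: "a u < a v + 1" if "u \<in> S" "v \<in> S" "(v, x) \<notin> P" for u v
    proof (cases "a v < a u")
      case True
      have "(v, u) \<notin> P"
        using that insert.hyps(2) pred[of u x v] by auto
      then show ?thesis using rep' that True by blast
    qed simp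
    \<comment> \<open>If \<open>v\<close> were placed to the left of \<open>u\<close>, its rank
      would be at most that of \<open>u\<close>, and it would share the successor \<open>x\<close>
      of \<open>u\<close>.\<close>
    have 2: "a u + 1 < a v + 1" if "u \<in> S" "v \<in> S" "(v, x) \<notin> P" "(u, x) \<in> P" for u v
    proof (rule ccontr)
      assume "\<not> a u + 1 < a v + 1"
      moreover have "a u \<noteq> a v" using inj that by (metis inj_onD)
      ultimately have "f v \<le> f u" using mono[of v u] that by simp
      then show False using succ[of v u x] that by auto
    qed
    have "l < r" if "l \<in> L" "r \<in> U" for l r
      using that 1 2 unfolding L_def U_def by auto
    moreover have "finite L" "finite U"
      using insert.hyps(1) unfolding L_def U_def by auto
    ultimately obtain r where r: "\<forall>l\<in>L. l < r" "\<forall>u\<in>U. r < u"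
      using separating_point by metis
    have r1: "a u < r" if "u \<in> S" for u using r(1) that unfolding L_def by auto
    have r2: "a u + 1 < r" if "u \<in> S" "(u, x) \<in> P" for u using r(1) that unfolding L_def by auto
    have r3: "r < a u + 1" if "u \<in> S" "(u, x) \<notin> P" for u using r(2) that unfolding U_def by auto
    define b where "b = a(x := r)"
    have b: "b x = r" "\<And>u. u \<in> S \<Longrightarrow> b u = a u"
      using False unfolding b_def by auto
    have "inj_on b S"
      using inj b(2) by (simp add: inj_on_def)
    moreover have "b x \<notin> b ` S"
      using b r1 by fastforce
    ultimately have "inj_on b (insert x S)"
      by (simp add: False inj_on_insert)
    moreover have "f u \<le> f v \<and> ((u, v) \<in> P \<longrightarrow> b u + 1 < b v) \<and> ((u, v) \<notin> P \<longrightarrow> b v < b u + 1)"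
      if uv: "u \<in> insert x S" "v \<in> insert x S" "b u < b v" for u v
    proof -
      have u: "u \<in> S"
      proof (rule ccontr)
        assume "u \<notin> S"
        then have "u = x" using uv(1) by simp
        then show False using uv(2,3) b r1[of v] by (cases "v = x") auto
      qed
      show ?thesis
      proof (cases "v = x")
        case True
        then show ?thesis
          using u b(1) b(2)[OF u] r2[OF u] r3[OF u] insert.hyps(2)[OF u] by simp
      next
        case False
        then have v: "v \<in> S" using uv(2) by simp
        have "a u < a v" using uv(3) b(2)[OF u] b(2)[OF v] by simp
        then show ?thesis
          using b(2)[OF u] b(2)[OF v] mono[OF u v] rep[OF u v] rep'[OF u v] by simp
      qed
    qed
    ultimately show ?thesis by blast
  qed
qed

theorem Scott_Suppes:
  assumes fin: "finite V" and PV: "P \<subseteq> V \<times> V" and irr: "irrefl P"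
    and no22: "\<And>a b c d. (a, b) \<in> P \<Longrightarrow> (c, d) \<in> P \<Longrightarrow> (a, d) \<in> P \<or> (c, b) \<in> P"
    and no31: "\<And>a b c d. (a, b) \<in> P \<Longrightarrow> (b, c) \<in> P \<Longrightarrow> d \<in> V \<Longrightarrow> (a, d) \<in> P \<or> (d, c) \<in> P"
  shows "semiorder_on V P"
proof -
  have irr': "(u, u) \<notin> P" for u using irr by (simp add: irrefl_def)
  \<comment> \<open>Transitivity is the degenerate case of \<open>no22\<close> in which
    \<open>c\<close> is \<open>b\<close>, as \<open>(b, b)\<close> is excluded.\<close>
  have tr: "trans P" using no22 irr' by (meson transI)
  define D where "D u = {w. (w, u) \<in> P}" for u
  define U where "U u = {w. (u, w) \<in> P}" for u
  \<comment> \<open>Predecessor sets form a chain, as do successor sets, and by \<open>no31\<close> the two chains are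
    compatible; so \<open>f\<close> refines both.\<close>
  define f where "f u = int (card (D u)) - int (card (U u))" for u
  have finD: "finite (D u)" and finU: "finite (U u)" for u
    using PV by (auto simp: D_def U_def intro: finite_subset[OF _ fin])
  have key: "D u \<subseteq> D v \<and> U v \<subseteq> U u" if uv: "u \<in> V" "v \<in> V" "f u \<le> f v" for u v
  proof -
    have DD: "D u \<subseteq> D v \<or> D v \<subset> D u" using no22 unfolding D_def by blast
    have UU: "U v \<subseteq> U u \<or> U u \<subset> U v" using no22 unfolding U_def by blast
    \<comment> \<open>Witnesses of two such strict inclusions form, around one of \<open>u\<close>
      and \<open>v\<close>, a chain of three to which the other is unrelated at both ends, against
      \<open>no31\<close>.\<close>
    have X: "\<not> (D v \<subset> D u \<and> U v \<subset> U u)" "\<not> (D u \<subset> D v \<and> U u \<subset> U v)"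
      using no31 uv(1,2) unfolding D_def U_def by blast+
    have sD: "card (D v) < card (D u)" if "D v \<subset> D u" using that finD psubset_card_mono by blast
    have sU: "card (U u) < card (U v)" if "U u \<subset> U v" using that finU psubset_card_mono by blast
    have wD: "card (D v) \<le> card (D u)" if "D v \<subseteq> D u" using that finD card_mono by blast
    have wU: "card (U u) \<le> card (U v)" if "U u \<subseteq> U v" using that finU card_mono by blast
    show ?thesis
    \<comment> \<open>If one of the two inclusions fails, then by \<open>X\<close> the other chain
      is reversed at least weakly, so that \<open>f v < f u\<close>.\<close>
    proof (rule ccontr)
      assume "\<not> ?thesis"
      then have "D v \<subset> D u \<and> U u \<subseteq> U v \<or> D v \<subseteq> D u \<and> U u \<subset> U v"
        using DD UU X by blast
      then show False using uv(3) sD sU wD wU unfolding f_def by fastforce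
    qed
  qed
  have pred: "(w, v) \<in> P" if "u \<in> V" "v \<in> V" "f u \<le> f v" "(w, u) \<in> P" for u v w
    using key[OF that(1-3)] that(4) unfolding D_def by blast
  have succ: "(u, w) \<in> P" if "u \<in> V" "v \<in> V" "f u \<le> f v" "(v, w) \<in> P" for u v w
    using key[OF that(1-3)] that(4) unfolding U_def by blast
  have "\<exists>a :: 'a \<Rightarrow> real. inj_on a V \<and> (\<forall>u\<in>V. \<forall>v\<in>V. a u < a v \<longrightarrow>
      f u \<le> f v \<and> ((u, v) \<in> P \<longrightarrow> a u + 1 < a v) \<and> ((u, v) \<notin> P \<longrightarrow> a v < a u + 1))"
    by (rule unit_representation[OF fin irr]) (fact pred succ)+
  then obtain a :: "'a \<Rightarrow> real" where inj: "inj_on a V"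
    and a: "\<And>u v. u \<in> V \<Longrightarrow> v \<in> V \<Longrightarrow> a u < a v \<Longrightarrow>
      f u \<le> f v \<and> ((u, v) \<in> P \<longrightarrow> a u + 1 < a v) \<and> ((u, v) \<notin> P \<longrightarrow> a v < a u + 1)"
    by blast
  have "(u, v) \<in> P \<longleftrightarrow> a u + 1 < a v" if uv: "u \<in> V" "v \<in> V" for u v
  proof
    assume P: "(u, v) \<in> P"
    have "a u \<noteq> a v" using P irr' inj uv by (metis inj_onD)
    \<comment> \<open>Otherwise \<open>u\<close> would inherit all predecessors of \<open>v\<close>,
      itself among them.\<close>
    moreover have "\<not> f v \<le> f u" using pred[OF uv(2,1) _ P] irr' by blast
    ultimately have "a u < a v" using a[OF uv(2,1)] by fastforce
    then show "a u + 1 < a v" using a[OF uv] P by blast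
  next
    assume "a u + 1 < a v"
    then show "(u, v) \<in> P" using a[OF uv] by fastforce
  qed
  then show ?thesis
    using semiorder_onI[OF fin _ inj, of P] PV irr tr unfolding strict_poset_on_def by blast
qed

section \<open>Short cycles in semiorientations\<close>

lemma (in pair_graph) edge_iff: "{u, v} \<in> edges G \<longleftrightarrow> (u, v) \<in> parcs G"
proof -
  have "(x, y) \<in> parcs G \<Longrightarrow> (y, x) \<in> parcs G" for x y
    using sym_arcs by (auto simp: symmetric_def sym_def)
  then show ?thesis
    unfolding edges_def undirected_def by (auto simp: doubleton_eq_iff)
qed

text \<open>This moves the count from undirected edges to arcs. By \<open>rev\<close> the cycle runs
  through no oriented edge backwards, so it is itself the direction that makes its edges a potential
  cycle; and with length at least 3 it uses each edge only once.\<close>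

lemma (in pair_graph) semiorientation_cycle:
  assumes Or: "semiorientation G Or" and p: "cycle p" "3 \<le> length p"
    and rev: "\<And>u v. (u, v) \<in> set p \<Longrightarrow> (v, u) \<notin> Or"
  shows "2 * card (set p \<inter> Or) < length p"
proof -
  define h where "h = (\<lambda>(x :: 'a, y). {x, y})"
  define C where "C = undirected (set p)"
  have C: "C = h ` set p" unfolding C_def undirected_def h_def ..
  have inj: "inj_on h (set p)" unfolding h_def by (rule inj_on_undirected_cycle[OF p])
  have dist: "distinct p" and sub: "set p \<subseteq> parcs G"
    using p(1) unfolding cycle_conv awalk_def by auto
  have dc: "set p \<in> directed_cycles G" unfolding directed_cycles_def using p by blast
  have agree: "(u, v) \<in> set p" if "(u, v) \<in> Or" "{u, v} \<in> C" for u v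
    using that rev unfolding C h_def by (auto simp: doubleton_eq_iff)
  have "potential_cycle G Or C"
    unfolding potential_cycle_def cycles_def using dc agree C_def by blast
  then have less: "card (C \<inter> oriented_edges G Or) < card (C \<inter> blank_edges G Or)"
    using Or unfolding semiorientation_def by blast
  have hO: "h e \<in> undirected Or \<longleftrightarrow> e \<in> Or" if "e \<in> set p" for e
  proof (cases e)
    case (Pair x y)
    then show ?thesis
      using that rev[of x y] unfolding undirected_def h_def
      by (auto simp: doubleton_eq_iff image_iff)
  qed
  have "C \<subseteq> edges G" unfolding C edges_def undirected_def h_def using sub by auto
  then have "C \<inter> oriented_edges G Or = h ` (set p \<inter> Or)" "C \<inter> blank_edges G Or = h ` (set p - Or)"
    using hO unfolding oriented_edges_def blank_edges_def C by auto
  then have "card (set p \<inter> Or) < card (set p - Or)"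
    using less inj by (simp add: card_image inj_on_subset[OF inj])
  moreover have "card (set p \<inter> Or) + card (set p - Or) = length p"
    using dist by (metis List.finite_set card_Int_Diff distinct_card)
  ultimately show ?thesis by linarith
qed

text \<open>Fewer than half of at most four arcs is at most one arc.\<close>

lemma (in pair_graph) semiorientation_few_oriented:
  assumes Or: "semiorientation G Or" and p: "cycle p" "3 \<le> length p" "length p \<le> 4"
    and rev: "\<And>u v. (u, v) \<in> set p \<Longrightarrow> (v, u) \<notin> Or"
    and e: "e \<in> set p" "e' \<in> set p" "e \<in> Or" "e' \<in> Or"
  shows "e = e'"
proof -
  have "card (set p \<inter> Or) \<le> 1"
    using semiorientation_cycle[OF Or p(1,2) rev] p(3) by linarith
  then show ?thesis
    using e card_le_Suc0_iff_eq[of "set p \<inter> Or"] by auto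
qed

section \<open>Complete graphs\<close>

lemma (in pair_graph) semiorder_of_complete_semiorientation:
  assumes arcs: "\<And>u v. (u, v) \<in> parcs G \<longleftrightarrow> u \<in> pverts G \<and> v \<in> pverts G \<and> u \<noteq> v"
    and Or: "semiorientation G Or"
  shows "semiorder_on (pverts G) Or"
proof -
  have po: "partial_orientation G Or" using Or unfolding semiorientation_def by blast
  have OV: "Or \<subseteq> pverts G \<times> pverts G" using po unfolding partial_orientation_def by blast
  have V: "u \<in> pverts G" "v \<in> pverts G" if "(u, v) \<in> Or" for u v using OV that by auto
  have asym: "(v, u) \<notin> Or" if "(u, v) \<in> Or" for u v
    using po that unfolding partial_orientation_def by blast
  then have irr: "(u, u) \<notin> Or" for u by blast
  have tr: "(x, z) \<in> Or" if "(x, y) \<in> Or" "(y, z) \<in> Or" for x y z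
  proof (rule ccontr)
    \<comment> \<open>The closing edge is now blank or oriented from \<open>z\<close> to
      \<open>x\<close>, so the triangle through \<open>x\<close>, \<open>y\<close>, \<open>z\<close>
      can be directed with two oriented arcs in it.\<close>
    assume n: "(x, z) \<notin> Or"
    have neq: "x \<noteq> y" "y \<noteq> z" "x \<noteq> z" using that asym irr by blast+
    let ?p = "[(x, y), (y, z), (z, x)]"
    have "cycle ?p"
      unfolding cycle_def awalk_def using neq V that arcs by (auto intro!: exI[of _ x])
    then have "(x, y) = (y, z)"
      by (rule semiorientation_few_oriented[OF Or]) (use that asym n in auto)
    then show False using neq by simp
  qed
  \<comment> \<open>The arcs \<open>e\<close> and \<open>e'\<close> are left open so that one
    statement serves both forbidden posets: the two oriented arcs are opposite for 2 + 2 and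
    consecutive for 3 + 1.\<close>
  have four: "e = e'"
    if "a \<in> pverts G" "b \<in> pverts G" "c \<in> pverts G" "d \<in> pverts G" "distinct [a, b, c, d]"
      and "(b, a) \<notin> Or" "(c, b) \<notin> Or" "(d, c) \<notin> Or" "(a, d) \<notin> Or"
      and "e \<in> {(a, b), (b, c), (c, d), (d, a)} \<inter> Or" "e' \<in> {(a, b), (b, c), (c, d), (d, a)} \<inter> Or"
    for a b c d e e'
  proof -
    let ?p = "[(a, b), (b, c), (c, d), (d, a)]"
    have "cycle ?p"
      unfolding cycle_def awalk_def using that arcs by (auto intro!: exI[of _ a])
    then show ?thesis
      by (rule semiorientation_few_oriented[OF Or]) (use that in auto)
  qed
  show ?thesis
  proof (rule Scott_Suppes)
    show "finite (pverts G)" by simp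
    show "Or \<subseteq> pverts G \<times> pverts G" by (rule OV)
    show "irrefl Or" using irr by (simp add: irrefl_def)
  next
    fix a b c d assume ab: "(a, b) \<in> Or" and cd: "(c, d) \<in> Or"
    show "(a, d) \<in> Or \<or> (c, b) \<in> Or"
    proof (rule ccontr)
      assume n: "\<not> ?thesis"
      \<comment> \<open>Transitivity rules out \<open>a = d\<close> and \<open>b = c\<close>. The
        two negations in \<open>n\<close> say exactly that the edges joining \<open>b\<close> to
        \<open>c\<close> and \<open>d\<close> to \<open>a\<close> are not oriented against the
        4-cycle.\<close>
      have "distinct [a, b, c, d]" using n ab cd tr irr by auto
      then show False
        using four[of a b c d "(a, b)" "(c, d)"] n ab cd V asym by auto
    qed
  next
    fix a b c d assume ab: "(a, b) \<in> Or" and bc: "(b, c) \<in> Or" and d: "d \<in> pverts G"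
    show "(a, d) \<in> Or \<or> (d, c) \<in> Or"
    proof (rule ccontr)
      assume n: "\<not> ?thesis"
      \<comment> \<open>The pair \<open>(a, c)\<close>, present by transitivity, rules out
        \<open>d = a\<close> and \<open>d = c\<close>; here \<open>n\<close> concerns the two edges
        at \<open>d\<close>.\<close>
      have "distinct [a, b, c, d]" using n ab bc tr[OF ab bc] irr by auto
      then show False
        using four[of a b c d "(a, b)" "(b, c)"] n ab bc d V asym by auto
    qed
  qed
qed

theorem theorem3p11:
  fixes G :: "'a pair_pre_digraph"
  assumes "pair_graph G"
    and "connected (with_proj G)"
  shows "bij_betw (nu G) (semiorders G) (semiorientations G) \<longleftrightarrow> complete_graph G"
proof -
  interpret pair_graph G by (rule assms(1))
  have wf: "u \<in> pverts G \<and> v \<in> pverts G \<and> u \<noteq> v" if "(u, v) \<in> parcs G" for u v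
    using that arc_fst_in_verts arc_snd_in_verts no_loops by fastforce
  have complete: "complete_graph G \<longleftrightarrow> (\<forall>u\<in>pverts G. \<forall>v\<in>pverts G. u \<noteq> v \<longrightarrow> (u, v) \<in> parcs G)"
    unfolding complete_graph_def complete_digraph_pair_def using wf by auto
  show ?thesis
  proof
    assume bij: "bij_betw (nu G) (semiorders G) (semiorientations G)"
    show "complete_graph G"
    proof (rule ccontr)
      assume "\<not> complete_graph G"
      then obtain x y where xy: "x \<in> pverts G" "y \<in> pverts G" "x \<noteq> y" "(x, y) \<notin> parcs G"
        unfolding complete by blast
      \<comment> \<open>With at most one pair \<open>no22\<close> is trivial, and as
        \<open>x\<close> differs from \<open>y\<close> there is no chain of three for
        \<open>no31\<close>.\<close>
      have "{} \<in> semiorders G" "{(x, y)} \<in> semiorders G"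
        unfolding semiorders_def mem_Collect_eq
        by (rule Scott_Suppes; use xy in \<open>auto simp: irrefl_def\<close>)+
      moreover have "nu G {} = nu G {(x, y)}"
        using xy(4) by (auto simp: nu_def edge_iff)
      ultimately show False
        using bij unfolding bij_betw_def by (metis inj_onD insert_not_empty)
    qed
  next
    assume "complete_graph G"
    then have arcs: "(u, v) \<in> parcs G \<longleftrightarrow> u \<in> pverts G \<and> v \<in> pverts G \<and> u \<noteq> v" for u v
      using complete wf by blast
    have nu_id: "nu G P = P" if "P \<in> semiorders G" for P
      using that unfolding nu_def edge_iff arcs semiorders_def semiorder_on_def strict_poset_on_def
      by (auto simp: irrefl_def)
    \<comment> \<open>Because \<open>nu G\<close> fixes every semiorder,
      \<open>nu_semiorientation\<close> becomes an inclusion of the semiorders in the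
      semiorientations.\<close>
    have "semiorientations G = semiorders G"
      using nu_semiorientation[OF assms(1)] nu_id semiorder_of_complete_semiorientation[OF arcs]
      unfolding semiorders_def semiorientations_def by fastforce
    then show "bij_betw (nu G) (semiorders G) (semiorientations G)"
      using nu_id by (simp add: bij_betw_cong[where g = id])
  qed
qed

end
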